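(* Let $H$ be a Hamiltonian on a finite-dimensional register $B$ of qubits, let $A$ be an ancillary register of qubits, and let $\beta>0$. Let $U(\boldsymbol\theta)=U_N\cdots U_1$ be a sequence of unitaries on $AB$, where each $U_j$ is either fixed or of the form $U_j=U_j(\theta_j)=e^{-iH_j\theta_j/2}$ with $\theta_j$ a real parameter (distinct parameterized gates having distinct parameters) and $H_j$ a tensor product of Pauli matrices. Let $\rho(\boldsymbol\theta)=\operatorname{tr}_A\big(U(\boldsymbol\theta)|00\rangle\langle 00|_{AB}U(\boldsymbol\theta)^\dagger\big)$ and $$\mathcal F_2(\boldsymbol\theta)=\operatorname{tr}(H\rho(\boldsymbol\theta))+\beta^{-1}\Big(2\operatorname{tr}(\rho(\boldsymbol\theta)^2)-\tfrac12\operatorname{tr}(\rho(\boldsymbol\theta)^3)-\tfrac32\Big).$$ Then for every index $m$ such that $U_m$ is a parameterized gate, $$\frac{\partial\mathcal F_2(\boldsymbol\theta)}{\partial\theta_m}=\tfrac12\Big(\langle K\rangle_{\theta_m+\frac\pi2}-\langle K\rangle_{\theta_m-\frac\pi2}\Big)+\beta^{-1}\Big[2\Big(\langle O\rangle_{\theta_m+\frac\pi2,\theta_m}-\langle O\rangle_{\theta_m-\frac\pi2,\theta_m}\Big)-\tfrac34\Big(\langle G\rangle_{\theta_m+\frac\pi2,\theta_m,\theta_m}-\langle G\rangle_{\theta_m-\frac\pi2,\theta_m,\theta_m}\Big)\Big].$$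
   Context: Fix $m$. Let $A_lB_l$, $l=1,\dots,6$, be copies of the registers $AB$, and let $\psi_{A_lB_l}=U_{m-1}\cdots U_1|00\rangle\langle00|_{A_lB_l}U_1^\dagger\cdots U_{m-1}^\dagger$. Let $W_1=\mathrm{SWAP}_{B_2B_3}\otimes I_{A_2A_3}$ and $W_2=(\mathrm{SWAP}_{B_4B_5}\otimes I_{A_4A_5A_6B_6})(\mathrm{SWAP}_{B_5B_6}\otimes I_{A_4B_4A_5A_6})$, where $\mathrm{SWAP}_{B_jB_l}$ swaps registers $B_j$ and $B_l$. Define $$K=U_{m+1}^\dagger\cdots U_N^\dagger(I_{A_1}\otimes H_{B_1})U_N\cdots U_{m+1},$$ $$O=(U_{m+1}^\dagger\cdots U_N^\dagger)^{\otimes2}W_1(U_N\cdots U_{m+1})^{\otimes2},\qquad G=(U_{m+1}^\dagger\cdots U_N^\dagger)^{\otimes3}W_2(U_N\cdots U_{m+1})^{\otimes3}.$$ For real $x,y,z$ write $$\langle K\rangle_x=\operatorname{tr}\big(U_m(x)\psi_{A_1B_1}U_m(x)^\dagger K\big),$$ $$\langle O\rangle_{x,y}=\operatorname{tr}\big([U_m(x)\psi_{A_2B_2}U_m(x)^\dagger\otimes U_m(y)\psi_{A_3B_3}U_m(y)^\dagger]\,O\big),$$ $$\langle G\rangle_{x,y,z}=\operatorname{tr}\big([U_m(x)\psi_{A_4B_4}U_m(x)^\dagger\otimes U_m(y)\psi_{A_5B_5}U_m(y)^\dagger\otimes U_m(z)\psi_{A_6B_6}U_m(z)^\dagger]\,G\big).$$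 All gates other than $U_m$ are evaluated at the current parameters $\boldsymbol\theta$. *)

theory Defs
  imports "HOL-Analysis.Analysis"
begin

(* An operator on a finite-dimensional space with computational basis 'n is a matrix
   complex^'n^'n.  The basis of a tensor product is the product type. *)

type_synonym 'n operator = "complex^'n^'n"

(* A type in this class is the computational basis of a register of nqubits many qubits,
   labelled by bit strings.  Every number of qubits occurs: unit has none, bool has one, and
   products concatenate registers. *)

class qubits = finite +
  fixes bits :: "'a \<Rightarrow> bool list"
    and nqubits :: "'a itself \<Rightarrow> nat"
  assumes bij_betw_bits: "bij_betw bits UNIV {xs. length xs = nqubits TYPE('a)}"

instantiation unit :: qubits
begin
definition bits_unit :: "unit \<Rightarrow> bool list" where "bits_unit x = []"
definition nqubits_unit :: "unit itself \<Rightarrow> nat" where "nqubits_unit _ = 0"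
instance
  by standard (auto simp: bits_unit_def nqubits_unit_def bij_betw_def inj_on_def)
end

instantiation bool :: qubits
begin
definition bits_bool :: "bool \<Rightarrow> bool list" where "bits_bool x = [x]"
definition nqubits_bool :: "bool itself \<Rightarrow> nat" where "nqubits_bool _ = 1"
instance
  by standard
    (auto simp: bits_bool_def nqubits_bool_def bij_betw_def inj_on_def length_Suc_conv image_def)
end

instantiation prod :: (qubits, qubits) qubits
begin
definition bits_prod :: "'a \<times> 'b \<Rightarrow> bool list"
  where "bits_prod x = bits (fst x) @ bits (snd x)"
definition nqubits_prod :: "('a \<times> 'b) itself \<Rightarrow> nat"
  where "nqubits_prod _ = nqubits TYPE('a) + nqubits TYPE('b)"
instance
proof
  have ba: "bij_betw bits (UNIV :: 'a set) {xs. length xs = nqubits TYPE('a)}"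
    and bb: "bij_betw bits (UNIV :: 'b set) {xs. length xs = nqubits TYPE('b)}"
    by (rule bij_betw_bits)+
  have la: "length (bits x) = nqubits TYPE('a)" for x :: 'a
    using bij_betwE[OF ba] by auto
  have lb: "length (bits x) = nqubits TYPE('b)" for x :: 'b
    using bij_betwE[OF bb] by auto
  have "inj (bits :: 'a \<times> 'b \<Rightarrow> bool list)"
  proof (rule injI)
    fix x y :: "'a \<times> 'b"
    assume "bits x = bits y"
    then have "bits (fst x) = bits (fst y)" "bits (snd x) = bits (snd y)"
      by (auto simp: bits_prod_def la)
    then show "x = y"
      using bij_betw_imp_inj_on[OF ba] bij_betw_imp_inj_on[OF bb]
      by (auto simp: prod_eq_iff inj_on_def)
  qed
  moreover have "range (bits :: 'a \<times> 'b \<Rightarrow> bool list) = {xs. length xs = nqubits TYPE('a \<times> 'b)}"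
  proof (intro equalityI subsetI)
    fix xs assume "xs \<in> range (bits :: 'a \<times> 'b \<Rightarrow> bool list)"
    then show "xs \<in> {xs. length xs = nqubits TYPE('a \<times> 'b)}"
      by (auto simp: bits_prod_def nqubits_prod_def la lb)
  next
    fix xs assume "xs \<in> {xs :: bool list. length xs = nqubits TYPE('a \<times> 'b)}"
    then have l: "length xs = nqubits TYPE('a) + nqubits TYPE('b)"
      by (simp add: nqubits_prod_def)
    have "take (nqubits TYPE('a)) xs \<in> range (bits :: 'a \<Rightarrow> bool list)"
      using l bij_betw_imp_surj_on[OF ba] by auto
    then obtain a :: 'a where a: "bits a = take (nqubits TYPE('a)) xs" by auto
    have "drop (nqubits TYPE('a)) xs \<in> range (bits :: 'b \<Rightarrow> bool list)"
      using l bij_betw_imp_surj_on[OF bb] by auto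
    then obtain b :: 'b where b: "bits b = drop (nqubits TYPE('a)) xs" by auto
    have "bits (a, b) = xs"
      by (simp add: bits_prod_def a b)
    then show "xs \<in> range (bits :: 'a \<times> 'b \<Rightarrow> bool list)" by (metis rangeI)
  qed
  ultimately show "bij_betw (bits :: 'a \<times> 'b \<Rightarrow> bool list) UNIV
      {xs. length xs = nqubits TYPE('a \<times> 'b)}"
    by (simp add: bij_betw_def)
qed
end

definition dagger :: "'n::finite operator \<Rightarrow> 'n operator" where
  "dagger M = (\<chi> i j. cnj (M $ j $ i))"

definition hermitian :: "'n::finite operator \<Rightarrow> bool" where
  "hermitian M \<longleftrightarrow> dagger M = M"

definition unitary :: "'n::finite operator \<Rightarrow> bool" where
  "unitary M \<longleftrightarrow> dagger M ** M = mat 1 \<and> M ** dagger M = mat 1"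

definition mexp :: "'n::finite operator \<Rightarrow> 'n operator" where
  "mexp M = (\<Sum>k. (1 / fact k) *\<^sub>R (((**) M ^^ k) (mat 1)))"

definition tensor :: "'m::finite operator \<Rightarrow> 'n::finite operator \<Rightarrow> ('m \<times> 'n) operator"
    (infixr "\<otimes>\<^sub>m" 75) where
  "M \<otimes>\<^sub>m N = (\<chi> i j. M $ fst i $ fst j * N $ snd i $ snd j)"

definition ptrace_fst :: "('a::finite \<times> 'b::finite) operator \<Rightarrow> 'b operator" where
  "ptrace_fst M = (\<chi> i j. \<Sum>a\<in>UNIV. M $ (a, i) $ (a, j))"

(* The operator sending the basis vector x to the basis vector f x. *)
definition basis_op :: "('n::finite \<Rightarrow> 'n) \<Rightarrow> 'n operator" where
  "basis_op f = (\<chi> i j. if i = f j then 1 else 0)"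

definition zero_state :: "'n::qubits operator" where
  "zero_state = (\<chi> i j. if True \<notin> set (bits i) \<and> True \<notin> set (bits j) then 1 else 0)"

datatype pauli = PauliI | PauliX | PauliY | PauliZ

(* False and True stand for the basis vectors 0 and 1. *)
fun pauli_mat :: "pauli \<Rightarrow> bool operator" where
  "pauli_mat PauliI = mat 1"
| "pauli_mat PauliX = (\<chi> i j. if i = j then 0 else 1)"
| "pauli_mat PauliY = (\<chi> i j. if i = j then 0 else if i then \<i> else - \<i>)"
| "pauli_mat PauliZ = (\<chi> i j. if i \<noteq> j then 0 else if i then -1 else 1)"

(* The tensor product of p 0, ..., p (n - 1), where n is the number of qubits; the remaining
   values of p are irrelevant. *)
definition pauli_tensor :: "(nat \<Rightarrow> pauli) \<Rightarrow> 'n::qubits operator" where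
  "pauli_tensor p =
     (\<chi> i j. \<Prod>k<nqubits TYPE('n). pauli_mat (p k) $ (bits i ! k) $ (bits j ! k))"

(* A gate is a function of its own real parameter; a fixed gate ignores it. *)

definition fixed_gate :: "(real \<Rightarrow> 'n::qubits operator) \<Rightarrow> bool" where
  "fixed_gate u \<longleftrightarrow> (\<exists>V. unitary V \<and> u = (\<lambda>_. V))"

definition parameterized_gate :: "(real \<Rightarrow> 'n::qubits operator) \<Rightarrow> bool" where
  "parameterized_gate u \<longleftrightarrow>
     (\<exists>p. u = (\<lambda>t. mexp (mat (- \<i> * complex_of_real t / 2) ** pauli_tensor p)))"

(* gates_prod U \<theta> i j = U_j ... U_i at the parameters \<theta>, the identity if j < i. *)
definition gates_prod ::
    "(nat \<Rightarrow> real \<Rightarrow> 'n::finite operator) \<Rightarrow> (nat \<Rightarrow> real) \<Rightarrow> nat \<Rightarrow> nat \<Rightarrow> 'n operator" where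
  "gates_prod U \<theta> i j = fold (\<lambda>k M. U k (\<theta> k) ** M) [i..<Suc j] (mat 1)"

context
  fixes U :: "nat \<Rightarrow> real \<Rightarrow> ('a::qubits \<times> 'b::qubits) operator"
    and N :: nat
    and H :: "'b operator"
begin

definition output_state :: "(nat \<Rightarrow> real) \<Rightarrow> 'b operator" where
  "output_state \<theta> =
     ptrace_fst (gates_prod U \<theta> 1 N ** zero_state ** dagger (gates_prod U \<theta> 1 N))"

(* Traces are complex numbers, so the (real) free energy is a complex number here. *)
definition free_energy2 :: "real \<Rightarrow> (nat \<Rightarrow> real) \<Rightarrow> complex" where
  "free_energy2 \<beta> \<theta> = (let \<rho> = output_state \<theta> in
     trace (H ** \<rho>) +
     complex_of_real (inverse \<beta>) * (2 * trace (\<rho> ** \<rho>) - 1/2 * trace (\<rho> ** \<rho> ** \<rho>) - 3/2))"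

definition psi :: "(nat \<Rightarrow> real) \<Rightarrow> nat \<Rightarrow> ('a \<times> 'b) operator" where
  "psi \<theta> m =
     gates_prod U \<theta> 1 (m - 1) ** zero_state ** dagger (gates_prod U \<theta> 1 (m - 1))"

definition psi_at :: "(nat \<Rightarrow> real) \<Rightarrow> nat \<Rightarrow> real \<Rightarrow> ('a \<times> 'b) operator" where
  "psi_at \<theta> m x = U m x ** psi \<theta> m ** dagger (U m x)"

definition later_gates :: "(nat \<Rightarrow> real) \<Rightarrow> nat \<Rightarrow> ('a \<times> 'b) operator" where
  "later_gates \<theta> m = gates_prod U \<theta> (m + 1) N"

definition K_obs :: "(nat \<Rightarrow> real) \<Rightarrow> nat \<Rightarrow> ('a \<times> 'b) operator" where
  "K_obs \<theta> m = dagger (later_gates \<theta> m) ** (mat 1 \<otimes>\<^sub>m H) ** later_gates \<theta> m"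

definition W1 :: "(('a \<times> 'b) \<times> ('a \<times> 'b)) operator" where
  "W1 = basis_op (\<lambda>((a2, b2), (a3, b3)). ((a2, b3), (a3, b2)))"

definition W2 :: "(('a \<times> 'b) \<times> ('a \<times> 'b) \<times> ('a \<times> 'b)) operator" where
  "W2 = basis_op (\<lambda>((a4, b4), (a5, b5), (a6, b6)). ((a4, b5), (a5, b4), (a6, b6))) **
        basis_op (\<lambda>((a4, b4), (a5, b5), (a6, b6)). ((a4, b4), (a5, b6), (a6, b5)))"

definition O_obs :: "(nat \<Rightarrow> real) \<Rightarrow> nat \<Rightarrow> (('a \<times> 'b) \<times> ('a \<times> 'b)) operator" where
  "O_obs \<theta> m = (let V = later_gates \<theta> m in
     (dagger V \<otimes>\<^sub>m dagger V) ** W1 ** (V \<otimes>\<^sub>m V))"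

definition G_obs ::
    "(nat \<Rightarrow> real) \<Rightarrow> nat \<Rightarrow> (('a \<times> 'b) \<times> ('a \<times> 'b) \<times> ('a \<times> 'b)) operator" where
  "G_obs \<theta> m = (let V = later_gates \<theta> m in
     (dagger V \<otimes>\<^sub>m dagger V \<otimes>\<^sub>m dagger V) ** W2 ** (V \<otimes>\<^sub>m V \<otimes>\<^sub>m V))"

definition K_exp :: "(nat \<Rightarrow> real) \<Rightarrow> nat \<Rightarrow> real \<Rightarrow> complex" where
  "K_exp \<theta> m x = trace (psi_at \<theta> m x ** K_obs \<theta> m)"

definition O_exp :: "(nat \<Rightarrow> real) \<Rightarrow> nat \<Rightarrow> real \<Rightarrow> real \<Rightarrow> complex" where
  "O_exp \<theta> m x y = trace ((psi_at \<theta> m x \<otimes>\<^sub>m psi_at \<theta> m y) ** O_obs \<theta> m)"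

definition G_exp :: "(nat \<Rightarrow> real) \<Rightarrow> nat \<Rightarrow> real \<Rightarrow> real \<Rightarrow> real \<Rightarrow> complex" where
  "G_exp \<theta> m x y z =
     trace ((psi_at \<theta> m x \<otimes>\<^sub>m psi_at \<theta> m y \<otimes>\<^sub>m psi_at \<theta> m z) ** G_obs \<theta> m)"

end

end

theory Submission
  imports Defs
begin

text \<open>
  Write a Pauli gate as $e^{-tQ/2}$ with $Q = iP$, where $Q$ is anti-Hermitian and
  $Q^2 = -1$.  Then $U_m(t) = \cos(t/2) - \sin(t/2)\,Q$, so the conjugated state
  $U_m(t)\,\psi\,U_m(t)^\dagger$, and with it the output state $\rho(t)$, has the form
  $A + \cos t\,B + \sin t\,C$; for such a function the central difference with step $\pi/2$
  is exactly twice the derivative.  The swap trick turns the expectations of $K$, $O$ and $G$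
  into $\mathrm{tr}(H\rho)$, $\mathrm{tr}(\rho\rho)$ and $\mathrm{tr}(\rho\rho\rho)$, and the product
  rule together with cyclicity of the trace gives the claim.
\<close>

section \<open>Real-linear structure of complex matrices\<close>

lemma linear_sums:
  fixes f :: "'c::euclidean_space \<Rightarrow> 'd::real_normed_vector"
  assumes "linear f" "g sums s"
  shows "(\<lambda>n. f (g n)) sums f s"
  using assms bounded_linear.sums linear_conv_bounded_linear by blast

text \<open>Serves twice: it yields the expansion rules in \<open>cmatrix_mult_simps\<close> and the
  product rule for derivatives of matrix-valued functions.\<close>

lemma bounded_bilinear_matrix_mult:
  "bounded_bilinear ((**) :: complex^'n^'m \<Rightarrow> complex^'p^'n \<Rightarrow> complex^'p^'m)"
  unfolding bilinear_conv_bounded_bilinear[symmetric] bilinear_def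
  by (auto intro!: linearI simp: matrix_add_ldistrib matrix_scalar_ac scalar_matrix_assoc
      matrix_matrix_mult_def vec_eq_iff sum.distrib algebra_simps scaleR_sum_right)

lemmas cmatrix_mult_simps =
  bounded_bilinear.add_left[OF bounded_bilinear_matrix_mult]
  bounded_bilinear.add_right[OF bounded_bilinear_matrix_mult]
  bounded_bilinear.diff_left[OF bounded_bilinear_matrix_mult]
  bounded_bilinear.diff_right[OF bounded_bilinear_matrix_mult]
  bounded_bilinear.minus_left[OF bounded_bilinear_matrix_mult]
  bounded_bilinear.minus_right[OF bounded_bilinear_matrix_mult]
  bounded_bilinear.scaleR_left[OF bounded_bilinear_matrix_mult]
  bounded_bilinear.scaleR_right[OF bounded_bilinear_matrix_mult]

lemma linear_trace: "linear (trace :: 'n::finite operator \<Rightarrow> complex)"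
  by (rule linearI) (simp_all add: trace_def sum.distrib scaleR_sum_right)

lemma linear_ptrace_fst:
  "linear (ptrace_fst :: ('c::finite \<times> 'd::finite) operator \<Rightarrow> 'd operator)"
  by (rule linearI) (simp_all add: ptrace_fst_def vec_eq_iff sum.distrib scaleR_sum_right)

lemma dagger_mult: "dagger (M ** N) = dagger N ** dagger M"
  by (simp add: dagger_def matrix_matrix_mult_def vec_eq_iff mult.commute)

lemma dagger_diff: "dagger (M - N) = dagger M - dagger N"
  by (simp add: dagger_def vec_eq_iff)

lemma dagger_scaleR: "dagger (r *\<^sub>R M) = r *\<^sub>R dagger M"
  by (simp add: dagger_def vec_eq_iff)

lemma dagger_mat: "dagger (mat z) = mat (cnj z)"
  by (simp add: dagger_def mat_def vec_eq_iff)

text \<open>Complex scalars appear as \<open>mat z\<close>, since \<open>scaleR\<close> multiplies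
  by reals only.\<close>

lemma mat_mult_entry: "(mat z ** M) $ i $ j = z * M $ i $ j"
  by (simp add: matrix_matrix_mult_def mat_def if_distrib[of "\<lambda>w. w * _"] cong: if_cong)

lemma mat_mult_commute: "M ** mat z = mat z ** (M :: 'n::finite operator)"
  unfolding vec_eq_iff mat_mult_entry
  by (simp add: matrix_matrix_mult_def mat_def if_distrib cong: if_cong)

section \<open>Pauli tensors\<close>

text \<open>Distributivity, one position at a time. It lets a matrix product of tensor products be
  computed qubit by qubit.\<close>

lemma sum_lists_prod:
  fixes f :: "nat \<Rightarrow> 'c::finite \<Rightarrow> 'd::comm_semiring_1"
  shows "(\<Sum>xs | length xs = n. \<Prod>k<n. f k (xs ! k)) = (\<Prod>k<n. \<Sum>c\<in>UNIV. f k c)"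
proof (induction n)
  case (Suc n)
  \<comment> \<open>The last entry is split off, not the first, so that positions below
    \<open>n\<close> keep their indices.\<close>
  have bij: "bij_betw (\<lambda>(xs, c). xs @ [c]) ({xs :: 'c list. length xs = n} \<times> UNIV)
      {xs. length xs = Suc n}"
    by (auto simp: bij_betw_def inj_on_def image_def length_Suc_conv_rev)
  have "(\<Sum>xs | length xs = Suc n. \<Prod>k<Suc n. f k (xs ! k)) =
      (\<Sum>(xs, c)\<in>{xs. length xs = n} \<times> UNIV. (\<Prod>k<n. f k (xs ! k)) * f n c)"
    by (subst sum.reindex_bij_betw[OF bij, symmetric])
      (auto simp: nth_append intro!: sum.cong)
  also have "\<dots> = (\<Sum>xs | length xs = n. \<Prod>k<n. f k (xs ! k)) * (\<Sum>c\<in>UNIV. f n c)"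
    by (simp add: sum.cartesian_product[symmetric] sum_product)
  finally show ?case using Suc.IH by simp
qed simp

lemma length_bits: "length (bits (x :: 'n::qubits)) = nqubits TYPE('n)"
  using bij_betwE[OF bij_betw_bits[where 'a='n]] by auto

lemma bits_eq_iff: "bits x = bits y \<longleftrightarrow> x = (y :: 'n::qubits)"
  using bij_betw_imp_inj_on[OF bij_betw_bits[where 'a='n]] by (auto simp: inj_on_def)

lemma sum_bits_prod:
  fixes f :: "nat \<Rightarrow> bool \<Rightarrow> 'd::comm_semiring_1"
  shows "(\<Sum>x\<in>(UNIV :: 'n::qubits set). \<Prod>k<nqubits TYPE('n). f k (bits x ! k)) =
    (\<Prod>k<nqubits TYPE('n). \<Sum>b\<in>UNIV. f k b)"
  unfolding sum_lists_prod[symmetric]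
  by (rule sum.reindex_bij_betw[OF bij_betw_bits])

lemma pauli_mat_square: "pauli_mat q ** pauli_mat q = mat 1"
  by (cases q) (auto simp: vec_eq_iff matrix_matrix_mult_def mat_def UNIV_bool)

lemma pauli_mat_hermitian: "cnj (pauli_mat q $ i $ j) = pauli_mat q $ j $ i"
  by (cases q) (auto simp: mat_def)

text \<open>An entry of the square factors over the qubits into entries of squared single-qubit
  Pauli matrices, so it is a product of Kronecker deltas.\<close>

lemma pauli_tensor_square: "pauli_tensor p ** pauli_tensor p = (mat 1 :: 'n::qubits operator)"
proof -
  have "(pauli_tensor p ** pauli_tensor p) $ i $ j = mat 1 $ i $ j" for i j :: 'n
  proof -
    have "(pauli_tensor p ** pauli_tensor p) $ i $ j =
        (\<Prod>k<nqubits TYPE('n). \<Sum>b\<in>UNIV.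
           pauli_mat (p k) $ (bits i ! k) $ b * pauli_mat (p k) $ b $ (bits j ! k))"
      unfolding sum_bits_prod[symmetric]
      by (simp add: matrix_matrix_mult_def pauli_tensor_def prod.distrib)
    also have "\<dots> = (\<Prod>k<nqubits TYPE('n). if bits i ! k = bits j ! k then 1 else 0)"
    proof (rule prod.cong[OF refl])
      fix k
      have "(\<Sum>b\<in>UNIV. pauli_mat (p k) $ x $ b * pauli_mat (p k) $ b $ y) =
          (mat 1 :: bool operator) $ x $ y" for x y
        unfolding pauli_mat_square[of "p k", symmetric] by (simp add: matrix_matrix_mult_def)
      then show "(\<Sum>b\<in>UNIV. pauli_mat (p k) $ (bits i ! k) $ b *
            pauli_mat (p k) $ b $ (bits j ! k)) = (if bits i ! k = bits j ! k then 1 else 0)"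
        by (simp add: mat_def)
    qed
    also have "\<dots> = (if \<forall>k<nqubits TYPE('n). bits i ! k = bits j ! k then 1 else 0)"
      by (auto intro!: prod.neutral prod_zero)
    \<comment> \<open>Both bit strings have length \<open>nqubits TYPE('n)\<close>, so agreement at
      every position makes them equal, and \<open>bits\<close> is injective.\<close>
    also have "(\<forall>k<nqubits TYPE('n). bits i ! k = bits j ! k) \<longleftrightarrow> i = j"
      using bits_eq_iff[of i j] list_eq_iff_nth_eq[of "bits i" "bits j"] by (simp add: length_bits)
    finally show ?thesis by (simp add: mat_def)
  qed
  then show ?thesis by (simp add: vec_eq_iff)
qed

lemma dagger_pauli_tensor: "dagger (pauli_tensor p) = pauli_tensor p"
  by (simp add: dagger_def pauli_tensor_def vec_eq_iff pauli_mat_hermitian)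

section \<open>Parameterized gates\<close>

text \<open>Euler's formula: \<open>Q\<close> acts as an imaginary unit, so the even powers in the
  exponential series collect to the cosine and the odd ones to the sine times
  \<open>Q\<close>.\<close>

lemma mexp_scaleR_imaginary_unit:
  fixes Q :: "'n::finite operator"
  assumes Q: "Q ** Q = - mat 1"
  shows "mexp (r *\<^sub>R Q) = cos r *\<^sub>R mat 1 + sin r *\<^sub>R Q"
proof -
  \<comment> \<open>Signs and exponents are written as in \<open>cos_coeff\<close> and
    \<open>sin_coeff\<close>, for the termwise comparison of the series below.\<close>
  have pow: "((**) (r *\<^sub>R Q) ^^ k) (mat 1) =
      (if even k then ((-1) ^ (k div 2) * r ^ k) *\<^sub>R mat 1
       else ((-1) ^ ((k - Suc 0) div 2) * r ^ k) *\<^sub>R Q)" for k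
  proof (induction k)
    case (Suc k)
    show ?case
    proof (cases "even k")
      case True
      then show ?thesis using Suc by (simp add: cmatrix_mult_simps algebra_simps)
    next
      case False
      then obtain l where "k = Suc (2 * l)" by (metis oddE Suc_eq_plus1)
      then show ?thesis using Suc by (simp add: cmatrix_mult_simps Q algebra_simps)
    qed
  qed simp
  have "(\<lambda>k. (cos_coeff k *\<^sub>R r ^ k) *\<^sub>R mat 1 + (sin_coeff k *\<^sub>R r ^ k) *\<^sub>R Q)
      sums (cos r *\<^sub>R mat 1 + sin r *\<^sub>R Q)"
    by (intro sums_add linear_sums[of "\<lambda>s. s *\<^sub>R _"] linearI cos_converges sin_converges)
      (auto simp: algebra_simps)
  also have "(\<lambda>k. (cos_coeff k *\<^sub>R r ^ k) *\<^sub>R mat 1 + (sin_coeff k *\<^sub>R r ^ k) *\<^sub>R Q) =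
      (\<lambda>k. (1 / fact k) *\<^sub>R ((**) (r *\<^sub>R Q) ^^ k) (mat 1))"
    by (rule ext) (simp add: pow cos_coeff_def sin_coeff_def)
  finally show ?thesis by (simp add: mexp_def sums_iff)
qed

text \<open>\<open>Q\<close> is i times the Pauli tensor P: P^2 = 1 makes it a square root of -1,
  and P being Hermitian makes it anti-Hermitian.\<close>

lemma parameterized_gate_cos_sin:
  fixes u :: "real \<Rightarrow> 'n::qubits operator"
  assumes "parameterized_gate u"
  obtains Q where "Q ** Q = - mat 1" "dagger Q = - Q"
    "\<forall>t. u t = cos (t/2) *\<^sub>R mat 1 - sin (t/2) *\<^sub>R Q"
proof -
  obtain p where u: "\<And>t. u t = mexp (mat (- \<i> * complex_of_real t / 2) ** pauli_tensor p)"
    using assms unfolding parameterized_gate_def by auto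
  define Q :: "'n operator" where "Q = mat \<i> ** pauli_tensor p"
  have "Q ** Q = (mat \<i> ** mat \<i>) ** (pauli_tensor p ** pauli_tensor p)"
    unfolding Q_def by (metis mat_mult_commute matrix_mul_assoc)
  also have "mat \<i> ** mat \<i> = (- mat 1 :: 'n operator)"
    unfolding vec_eq_iff mat_mult_entry by (simp add: mat_def)
  finally have QQ: "Q ** Q = - mat 1"
    by (simp add: pauli_tensor_square)
  have "dagger Q = - Q"
    unfolding Q_def dagger_mult dagger_mat dagger_pauli_tensor mat_mult_commute
    unfolding vec_eq_iff by (simp add: mat_mult_entry)
  moreover have "\<forall>t. u t = cos (t/2) *\<^sub>R mat 1 - sin (t/2) *\<^sub>R Q"
  proof
    fix t
    \<comment> \<open>The exponent is the real multiple -t/2 of \<open>Q\<close>; oddness of the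
      sine then gives the minus sign.\<close>
    have "mat (- \<i> * complex_of_real t / 2) ** pauli_tensor p = (- (t/2)) *\<^sub>R Q"
      unfolding vec_eq_iff Q_def vector_scaleR_component mat_mult_entry
      by (simp add: scaleR_conv_of_real)
    then show "u t = cos (t/2) *\<^sub>R mat 1 - sin (t/2) *\<^sub>R Q"
      unfolding u by (simp only: mexp_scaleR_imaginary_unit[OF QQ] cos_minus sin_minus) simp
  qed
  ultimately show thesis by (rule that[OF QQ])
qed

text \<open>Conjugation is quadratic in cos(t/2) and sin(t/2), so the double-angle formulas leave
  only a constant, cos t and sin t.\<close>

lemma parameterized_gate_conjugation:
  fixes u :: "real \<Rightarrow> 'n::qubits operator"
  assumes "parameterized_gate u"
  obtains A B C where "\<forall>t. u t ** M ** dagger (u t) = A + cos t *\<^sub>R B + sin t *\<^sub>R C"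
proof -
  obtain Q where "Q ** Q = - mat 1" and Q: "dagger Q = - Q"
    and u: "\<forall>t. u t = cos (t/2) *\<^sub>R mat 1 - sin (t/2) *\<^sub>R Q"
    using parameterized_gate_cos_sin[OF assms] .
  have "u t ** M ** dagger (u t) = (1/2) *\<^sub>R (M - Q ** M ** Q)
      + cos t *\<^sub>R ((1/2) *\<^sub>R (M + Q ** M ** Q)) + sin t *\<^sub>R ((1/2) *\<^sub>R (M ** Q - Q ** M))" for t
  proof -
    have c2: "(cos (t/2))\<^sup>2 = (1 + cos t) / 2"
      using cos_double_cos[of "t/2"] by simp
    have s2: "(sin (t/2))\<^sup>2 = (1 - cos t) / 2"
      using cos_double_sin[of "t/2"] by simp
    have sc: "sin (t/2) * cos (t/2) = sin t / 2"
      using sin_double[of "t/2"] by simp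
    have "u t ** M ** dagger (u t) = (cos (t/2))\<^sup>2 *\<^sub>R M - (sin (t/2))\<^sup>2 *\<^sub>R (Q ** M ** Q)
       + (sin (t/2) * cos (t/2)) *\<^sub>R (M ** Q - Q ** M)"
      unfolding u[rule_format] dagger_diff dagger_scaleR dagger_mat Q
      by (simp add: cmatrix_mult_simps algebra_simps power2_eq_square)
    also have "\<dots> = ((1 + cos t) / 2) *\<^sub>R M - ((1 - cos t) / 2) *\<^sub>R (Q ** M ** Q)
       + (sin t / 2) *\<^sub>R (M ** Q - Q ** M)"
      unfolding c2 s2 sc ..
    also have "\<dots> = (1/2) *\<^sub>R (M - Q ** M ** Q)
      + cos t *\<^sub>R ((1/2) *\<^sub>R (M + Q ** M ** Q)) + sin t *\<^sub>R ((1/2) *\<^sub>R (M ** Q - Q ** M))"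
      by (simp add: add_divide_distrib diff_divide_distrib algebra_simps)
    finally show ?thesis .
  qed
  then show thesis by (intro that allI)
qed

text \<open>The difference cancels \<open>A\<close> and turns cos t into -2 sin t and sin t into 2
  cos t. Vector values allow its use on the state itself, before any trace is taken.\<close>

lemma parameter_shift:
  fixes f :: "real \<Rightarrow> 'c::real_normed_vector"
  assumes f: "\<And>t. f t = A + cos t *\<^sub>R B + sin t *\<^sub>R C"
  shows "(f has_vector_derivative (1/2) *\<^sub>R (f (t + pi/2) - f (t - pi/2))) (at t)"
proof -
  have "((\<lambda>t. A + cos t *\<^sub>R B + sin t *\<^sub>R C) has_vector_derivative
      (- sin t) *\<^sub>R B + cos t *\<^sub>R C) (at t)"
    by (auto intro!: derivative_eq_intros)
  moreover have "(1/2) *\<^sub>R (f (t + pi/2) - f (t - pi/2)) = (- sin t) *\<^sub>R B + cos t *\<^sub>R C"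
    unfolding f by (simp add: cos_add sin_add cos_diff sin_diff algebra_simps flip: scaleR_add_left)
  moreover have "f = (\<lambda>t. A + cos t *\<^sub>R B + sin t *\<^sub>R C)"
    using f by auto
  ultimately show ?thesis by simp
qed

section \<open>The swap trick\<close>

lemma trace_mult_basis_op: "trace (M ** basis_op f) = (\<Sum>i\<in>UNIV. M $ i $ f i)"
  by (simp add: trace_def matrix_matrix_mult_def basis_op_def if_distrib cong: if_cong)

lemma basis_op_mult: "basis_op f ** basis_op g = basis_op (f \<circ> g)"
  by (simp add: vec_eq_iff matrix_matrix_mult_def basis_op_def
      if_distrib[of "\<lambda>w. z * w" for z] cong: if_cong)

lemma tensor_mult: "(A \<otimes>\<^sub>m B) ** (C \<otimes>\<^sub>m D) = (A ** C) \<otimes>\<^sub>m (B ** D)"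
  by (simp add: vec_eq_iff matrix_matrix_mult_def tensor_def sum_product sum.cartesian_product
      UNIV_Times_UNIV[symmetric] mult_ac split_def del: UNIV_Times_UNIV)

lemma sum_UNIV_prod:
  "(\<Sum>x\<in>UNIV. f x) = (\<Sum>a\<in>(UNIV :: 'c::finite set). \<Sum>b\<in>(UNIV :: 'd::finite set). f (a, b))"
  by (simp add: sum.cartesian_product)

text \<open>The identity on the first factor forces equal first indices, and summing over those is
  the partial trace.\<close>

lemma trace_ptrace_fst: "trace (X ** (mat 1 \<otimes>\<^sub>m H)) = trace (ptrace_fst X ** H)"
proof -
  have delta: "(\<Sum>x\<in>UNIV. \<Sum>y\<in>UNIV. if x = a then F y else 0) = (\<Sum>y\<in>UNIV. F y)"
    for a :: "'c::finite" and F :: "'d::finite \<Rightarrow> complex"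
    by (subst sum.swap) simp
  have "trace (X ** (mat 1 \<otimes>\<^sub>m H)) =
      (\<Sum>a\<in>UNIV. \<Sum>b\<in>UNIV. \<Sum>d\<in>UNIV. X $ (a, b) $ (a, d) * H $ d $ b)"
    unfolding trace_def matrix_matrix_mult_def tensor_def sum_UNIV_prod
    by (simp add: mat_def if_distrib if_distribR delta cong: if_cong)
  also have "\<dots> = (\<Sum>b\<in>UNIV. \<Sum>d\<in>UNIV. \<Sum>a\<in>UNIV. X $ (a, b) $ (a, d) * H $ d $ b)"
    by (subst sum.swap) (intro sum.cong refl sum.swap)
  also have "\<dots> = trace (ptrace_fst X ** H)"
    by (simp add: trace_def matrix_matrix_mult_def ptrace_fst_def sum_distrib_right)
  finally show ?thesis .
qed

text \<open>Swapping the B indices while the A indices stay diagonal links the two partial traces in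
  a cycle of length two.\<close>

lemma trace_tensor_W1: "trace ((X \<otimes>\<^sub>m Y) ** W1) = trace (ptrace_fst X ** ptrace_fst Y)"
proof -
  have "trace ((X \<otimes>\<^sub>m Y) ** W1) =
      (\<Sum>((a2, b2), (a3, b3))\<in>UNIV. X $ (a2, b2) $ (a2, b3) * Y $ (a3, b3) $ (a3, b2))"
    by (simp add: W1_def trace_mult_basis_op tensor_def split_def)
  also have "\<dots> = (\<Sum>(b2, b3, a2, a3)\<in>UNIV. X $ (a2, b2) $ (a2, b3) * Y $ (a3, b3) $ (a3, b2))"
    by (rule sum.reindex_bij_witness[of _ "\<lambda>(b2, b3, a2, a3). ((a2, b2), (a3, b3))"
          "\<lambda>((a2, b2), (a3, b3)). (b2, b3, a2, a3)"]) auto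
  also have "\<dots> = trace (ptrace_fst X ** ptrace_fst Y)"
    by (simp only: trace_def matrix_matrix_mult_def ptrace_fst_def sum_product sum_UNIV_prod
        vec_lambda_beta case_prod_conv)
  finally show ?thesis .
qed

text \<open>The composed swaps send (b4, b5, b6) to (b6, b4, b5). Following the cycle from b4 visits
  \<open>X\<close>, \<open>Z\<close>, \<open>Y\<close>, hence the exchanged order of the last two
  factors.\<close>

lemma trace_tensor_W2:
  "trace ((X \<otimes>\<^sub>m Y \<otimes>\<^sub>m Z) ** W2) = trace (ptrace_fst X ** ptrace_fst Z ** ptrace_fst Y)"
proof -
  have "trace ((X \<otimes>\<^sub>m Y \<otimes>\<^sub>m Z) ** W2) =
      (\<Sum>((a4, b4), (a5, b5), (a6, b6))\<in>UNIV.
        X $ (a4, b4) $ (a4, b6) * (Y $ (a5, b5) $ (a5, b4) * Z $ (a6, b6) $ (a6, b5)))"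
    by (simp add: W2_def basis_op_mult trace_mult_basis_op tensor_def split_def)
  \<comment> \<open>The tuple lists the indices in the order of the nested sums to which the
    right-hand side unfolds.\<close>
  also have "\<dots> = (\<Sum>(b4, b5, a5, b6, a6, a4)\<in>UNIV.
        X $ (a4, b4) $ (a4, b6) * Z $ (a6, b6) $ (a6, b5) * Y $ (a5, b5) $ (a5, b4))"
    by (rule sum.reindex_bij_witness[of _
          "\<lambda>(b4, b5, a5, b6, a6, a4). ((a4, b4), (a5, b5), (a6, b6))"
          "\<lambda>((a4, b4), (a5, b5), (a6, b6)). (b4, b5, a5, b6, a6, a4)"]) auto
  also have "\<dots> = trace (ptrace_fst X ** ptrace_fst Z ** ptrace_fst Y)"
    by (simp only: trace_def matrix_matrix_mult_def ptrace_fst_def sum_distrib_right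
        sum_distrib_left sum_UNIV_prod vec_lambda_beta case_prod_conv)
  finally show ?thesis .
qed

text \<open>Cyclicity moves the conjugation by the later gates from the observable to the
  state.\<close>

lemma trace_rotate: "trace (X ** (E ** W ** V)) = trace ((V ** X ** E) ** W)"
  for X E W V :: "'n::finite operator"
  by (metis matrix_mul_assoc trace_mul_sym)

section \<open>The circuit around one gate\<close>

lemma gates_prod_cong:
  assumes "\<And>k. k \<in> {i..j} \<Longrightarrow> \<theta> k = \<theta>' k"
  shows "gates_prod U \<theta> i j = gates_prod U \<theta>' i j"
  unfolding gates_prod_def using assms by (intro fold_cong) auto

lemma gates_prod_split:
  fixes U :: "nat \<Rightarrow> real \<Rightarrow> 'n::finite operator"
  assumes "1 \<le> m" "m \<le> N"
  shows "gates_prod U \<theta> 1 N =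
    gates_prod U \<theta> (m + 1) N ** U m (\<theta> m) ** gates_prod U \<theta> 1 (m - 1)"
proof -
  \<comment> \<open>Associativity pulls the start value out of the fold, so that the product can be
    cut at \<open>m\<close>.\<close>
  have fold: "fold (\<lambda>k M. U k (\<theta> k) ** M) ks M = fold (\<lambda>k M. U k (\<theta> k) ** M) ks (mat 1) ** M"
    for ks and M :: "'n operator"
  proof (induction ks arbitrary: M)
    case (Cons k ks)
    show ?case
      using Cons.IH[of "U k (\<theta> k) ** M"] Cons.IH[of "U k (\<theta> k)"] by (simp add: matrix_mul_assoc)
  qed simp
  \<comment> \<open>As m \<ge> 1, \<open>Suc (m - 1)\<close> is \<open>m\<close>; the first block is
    empty for m = 1 and the last for m = N.\<close>
  have "[1..<Suc N] = [1..<Suc (m - 1)] @ m # [m + 1..<Suc N]"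
    using assms upt_add_eq_append[of 1 m "Suc N - m"] upt_conv_Cons[of m "Suc N"]
    by (simp del: upt_Suc)
  then show ?thesis
    unfolding gates_prod_def
    by (simp del: upt_Suc, subst fold) (simp add: matrix_mul_assoc)
qed

text \<open>The output state as a function of the m-th parameter alone, written through
  \<open>psi_at\<close>, in terms of which the expectations are defined.\<close>

definition shifted_state ::
    "(nat \<Rightarrow> real \<Rightarrow> ('a::qubits \<times> 'b::qubits) operator) \<Rightarrow> nat \<Rightarrow>
      (nat \<Rightarrow> real) \<Rightarrow> nat \<Rightarrow> real \<Rightarrow> 'b operator"
  where "shifted_state U N \<theta> m x =
    ptrace_fst (later_gates U N \<theta> m ** psi_at U \<theta> m x ** dagger (later_gates U N \<theta> m))"

text \<open>The gates before and after position \<open>m\<close> do not read the m-th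
  parameter.\<close>

lemma output_state_eq_shifted_state:
  assumes "m \<in> {1..N}"
  shows "output_state U N (\<theta>(m := t)) = shifted_state U N \<theta> m t"
proof -
  have "gates_prod U (\<theta>(m := t)) (m + 1) N = later_gates U N \<theta> m"
    unfolding later_gates_def by (rule gates_prod_cong) simp
  moreover have "gates_prod U (\<theta>(m := t)) 1 (m - 1) = gates_prod U \<theta> 1 (m - 1)"
    using assms by (intro gates_prod_cong) auto
  ultimately have "gates_prod U (\<theta>(m := t)) 1 N =
      later_gates U N \<theta> m ** U m t ** gates_prod U \<theta> 1 (m - 1)"
    using assms gates_prod_split[of m N U "\<theta>(m := t)"] by simp
  then show ?thesis
    by (simp add: output_state_def shifted_state_def psi_at_def psi_def dagger_mult matrix_mul_assoc)
qed

text \<open>Here and for the other two expectations, rotating the trace conjugates the states by the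
  later gates and leaves only H, \<open>W1\<close> or \<open>W2\<close> as observable.\<close>

lemma K_exp_eq: "K_exp U N H \<theta> m x = trace (H ** shifted_state U N \<theta> m x)"
  unfolding K_exp_def K_obs_def shifted_state_def trace_rotate trace_ptrace_fst
  by (rule trace_mul_sym)

lemma O_exp_eq:
  "O_exp U N \<theta> m x y = trace (shifted_state U N \<theta> m x ** shifted_state U N \<theta> m y)"
  unfolding O_exp_def O_obs_def Let_def trace_rotate tensor_mult trace_tensor_W1
    shifted_state_def ..

text \<open>\<open>z\<close> precedes \<open>y\<close> because \<open>W2\<close> cycles the
  registers in that order; in the gradient both equal \<open>\<theta> m\<close>.\<close>

lemma G_exp_eq:
  "G_exp U N \<theta> m x y z =
    trace (shifted_state U N \<theta> m x ** shifted_state U N \<theta> m z ** shifted_state U N \<theta> m y)"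
  unfolding G_exp_def G_obs_def Let_def trace_rotate tensor_mult trace_tensor_W2
    shifted_state_def ..

text \<open>The map from \<open>psi_at\<close> to the output state is real-linear, so the form A +
  cos t B + sin t C survives it.\<close>

lemma shifted_state_has_vector_derivative:
  assumes "parameterized_gate (U m)"
  shows "(shifted_state U N \<theta> m has_vector_derivative
    (1/2) *\<^sub>R (shifted_state U N \<theta> m (t + pi/2) - shifted_state U N \<theta> m (t - pi/2))) (at t)"
proof -
  obtain A B C where ABC: "\<forall>t. psi_at U \<theta> m t = A + cos t *\<^sub>R B + sin t *\<^sub>R C"
    unfolding psi_at_def using parameterized_gate_conjugation[OF assms] .
  define L where "L X = ptrace_fst (later_gates U N \<theta> m ** X ** dagger (later_gates U N \<theta> m))" for X
  have "shifted_state U N \<theta> m t = L A + cos t *\<^sub>R L B + sin t *\<^sub>R L C" for t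
    unfolding shifted_state_def ABC[rule_format] L_def
    by (simp add: cmatrix_mult_simps linear_add[OF linear_ptrace_fst] linear_scale[OF linear_ptrace_fst])
  then show ?thesis by (rule parameter_shift)
qed

section \<open>The derivative of the free energy\<close>

lemma trace_has_vector_derivative:
  fixes f :: "real \<Rightarrow> 'n::finite operator"
  assumes "(f has_vector_derivative D) F"
  shows "((\<lambda>t. trace (f t)) has_vector_derivative trace D) F"
  using bounded_linear.has_vector_derivative[OF _ assms] linear_trace
  by (simp add: linear_conv_bounded_linear)

theorem mainTheorem2:
  fixes U :: "nat \<Rightarrow> real \<Rightarrow> ('a::qubits \<times> 'b::qubits) operator"
    and H :: "'b operator"
    and \<theta> :: "nat \<Rightarrow> real"
    and \<beta> :: real
    and N m :: nat
  assumes H: "hermitian H"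
    and \<beta>: "\<beta> > 0"
    and gates: "\<And>j. j \<in> {1..N} \<Longrightarrow> fixed_gate (U j) \<or> parameterized_gate (U j)"
    and m: "m \<in> {1..N}" "parameterized_gate (U m)"
  shows "((\<lambda>t. free_energy2 U N H \<beta> (\<theta>(m := t))) has_vector_derivative
      (1/2 * (K_exp U N H \<theta> m (\<theta> m + pi/2) - K_exp U N H \<theta> m (\<theta> m - pi/2))
       + complex_of_real (inverse \<beta>) *
         (2 * (O_exp U N \<theta> m (\<theta> m + pi/2) (\<theta> m) - O_exp U N \<theta> m (\<theta> m - pi/2) (\<theta> m))
          - 3/4 * (G_exp U N \<theta> m (\<theta> m + pi/2) (\<theta> m) (\<theta> m)
                   - G_exp U N \<theta> m (\<theta> m - pi/2) (\<theta> m) (\<theta> m)))))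
      (at (\<theta> m))"
  proof -
  define \<rho> where "\<rho> = shifted_state U N \<theta> m"
  define D where "D = (1/2) *\<^sub>R (\<rho> (\<theta> m + pi/2) - \<rho> (\<theta> m - pi/2))"
  let ?r = "\<rho> (\<theta> m)"
  have d: "(\<rho> has_vector_derivative D) (at (\<theta> m))"
    unfolding \<rho>_def D_def by (rule shifted_state_has_vector_derivative) (rule m(2))
  \<comment> \<open>Matrices need not commute, so the order of the factors is kept until a trace is
    taken.\<close>
  have dmult: "((\<lambda>t. f t ** g t) has_vector_derivative f t ** g' + f' ** g t) (at t)"
    if "(f has_vector_derivative f') (at t)" "(g has_vector_derivative g') (at t)"
    for f g :: "real \<Rightarrow> 'b operator" and f' g' t
    by (rule bounded_bilinear.has_vector_derivative[OF bounded_bilinear_matrix_mult that])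
  have tr_r2: "trace (?r ** D + D ** ?r) = 2 * trace (D ** ?r)"
    by (simp add: trace_add trace_mul_sym[of ?r])
  \<comment> \<open>Cyclicity makes the three terms in the derivative of tr \<rho>^3 equal.\<close>
  have "trace (?r ** ?r ** D) = trace (D ** ?r ** ?r)"
    using trace_mul_sym[of "?r ** ?r" D] by (simp add: matrix_mul_assoc)
  moreover have "trace (?r ** D ** ?r) = trace (D ** ?r ** ?r)"
    using trace_mul_sym[of ?r "D ** ?r"] by (simp add: matrix_mul_assoc)
  ultimately have tr_r3: "trace (?r ** ?r ** D + (?r ** D + D ** ?r) ** ?r) = 3 * trace (D ** ?r ** ?r)"
    by (simp add: trace_add cmatrix_mult_simps)
  \<comment> \<open>Each expectation is linear in its shifted state, the other states staying at
    \<open>\<theta> m\<close>; the factor 2 in the last two clears the 1/2 in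
    \<open>D\<close>.\<close>
  have eq1: "trace (H ** D) = 1/2 * (K_exp U N H \<theta> m (\<theta> m + pi/2) - K_exp U N H \<theta> m (\<theta> m - pi/2))"
    and eq2: "2 * trace (D ** ?r) = O_exp U N \<theta> m (\<theta> m + pi/2) (\<theta> m) - O_exp U N \<theta> m (\<theta> m - pi/2) (\<theta> m)"
    and eq3: "2 * trace (D ** ?r ** ?r) =
      G_exp U N \<theta> m (\<theta> m + pi/2) (\<theta> m) (\<theta> m) - G_exp U N \<theta> m (\<theta> m - pi/2) (\<theta> m) (\<theta> m)"
    unfolding K_exp_eq O_exp_eq G_exp_eq \<rho>_def[symmetric] D_def
      cmatrix_mult_simps linear_scale[OF linear_trace] trace_sub
    by (simp_all add: scaleR_conv_of_real)
  \<comment> \<open>The final \<open>- 0\<close> is the derivative of the constant 3/2.\<close>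
  have "((\<lambda>t. trace (H ** \<rho> t) + complex_of_real (inverse \<beta>) *
        (2 * trace (\<rho> t ** \<rho> t) - 1/2 * trace (\<rho> t ** \<rho> t ** \<rho> t) - 3/2))
      has_vector_derivative trace (H ** D) + complex_of_real (inverse \<beta>) *
        (2 * trace (?r ** D + D ** ?r) - 1/2 * trace (?r ** ?r ** D + (?r ** D + D ** ?r) ** ?r) - 0))
      (at (\<theta> m))"
    by (intro has_vector_derivative_add has_vector_derivative_diff has_vector_derivative_const
        has_vector_derivative_mult_right trace_has_vector_derivative dmult d
        bounded_linear.has_vector_derivative[OF
          bounded_bilinear.bounded_linear_right[OF bounded_bilinear_matrix_mult]])
  \<comment> \<open>The coefficient 3/4 arises as 1/2 * 3 = 3/4 * 2, the 3 coming from the three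
    equal terms.\<close>
  moreover have "trace (H ** D) + complex_of_real (inverse \<beta>) *
        (2 * trace (?r ** D + D ** ?r) - 1/2 * trace (?r ** ?r ** D + (?r ** D + D ** ?r) ** ?r) - 0) =
      trace (H ** D) + complex_of_real (inverse \<beta>) *
        (2 * (2 * trace (D ** ?r)) - 3/4 * (2 * trace (D ** ?r ** ?r)))"
    unfolding tr_r2 tr_r3 by simp
  moreover have "free_energy2 U N H \<beta> (\<theta>(m := t)) = trace (H ** \<rho> t) + complex_of_real (inverse \<beta>) *
        (2 * trace (\<rho> t ** \<rho> t) - 1/2 * trace (\<rho> t ** \<rho> t ** \<rho> t) - 3/2)" for t
    unfolding free_energy2_def Let_def \<rho>_def output_state_eq_shifted_state[OF m(1)] ..
  ultimately show ?thesis
    by (simp only: eq1 eq2 eq3)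
qed

end
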